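(* Let $\mathcal{H}_1,\mathcal{H}_2$ be separable complex Hilbert spaces and $E_1,E_2$ infinite complex matrices. Let $\Phi=\{\phi_k\}_{k=1}^{\infty}\subseteq\mathcal{H}_1$ be an $E_1$-Bessel sequence with bound $B$, let $\Psi=\{\psi_k\}_{k=1}^{\infty}\subseteq\mathcal{H}_2$ be an $E_2$-Bessel sequence with bound $B'$, and let $M^{(E_1,E_2)}_{m,\Psi,\Phi}$ be the corresponding $(E_1,E_2)$-multiplier with symbol $m=\{m_n\}_{n=1}^\infty$. If $m\in\ell^\infty$, then $M^{(E_1,E_2)}_{m,\Psi,\Phi}$ is a well-defined bounded operator from $\mathcal{H}_1$ to $\mathcal{H}_2$ such that $$\left\|M^{(E_1,E_2)}_{m,\Psi,\Phi}\right\|\le\sqrt{B}\,\sqrt{B'}\,\|m\|_\infty .$$ Moreover, the series $\sum_{k=1}^\infty m_k\langle f,(E_1\Phi)_k\rangle(E_2\Psi)_k$ converges unconditionally for all $f\in\mathcal{H}_1$.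
   Context: For an infinite complex matrix $E=(E_{n,k})_{n,k\ge1}$ and a sequence $\Phi=\{\phi_k\}_{k=1}^\infty$ in a Hilbert space $\mathcal{H}$, write $E\Phi=E\{\phi_k\}_{k=1}^\infty=\{\sum_{k=1}^\infty E_{n,k}\phi_k\}_{n=1}^\infty$, with $n$-th term $(E\Phi)_n$. $\Phi$ is an $E$-sequence if all these series converge in $\mathcal{H}$. $\Phi$ is $E$-Bessel with bound $B>0$ if it is an $E$-sequence and $\sum_{n=1}^\infty|\langle f,(E\Phi)_n\rangle|^2\le B\|f\|^2$ for all $f\in\mathcal{H}$. For an $E_1$-sequence $\Phi$ in $\mathcal{H}_1$, an $E_2$-sequence $\Psi$ in $\mathcal{H}_2$ and a complex sequence $m=\{m_n\}_{n=1}^\infty$ (the symbol), the $(E_1,E_2)$-multiplier is $M^{(E_1,E_2)}_{m,\Psi,\Phi}f=\sum_{n=1}^\infty m_n\langle f,(E_1\Phi)_n\rangle(E_2\Psi)_n$; it is well defined if this series converges for every $f\in\mathcal{H}_1$. *)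

theory Defs
  imports "HOL-Analysis.Analysis"
begin

text \<open>
  The norm is required to be the one induced by the inner product, so positive
  definiteness follows from the norm axioms. The inner product is linear in its
  first argument.
\<close>

class complex_inner = real_normed_vector +
  fixes scaleC :: "complex \<Rightarrow> 'a \<Rightarrow> 'a" (infixr \<open>*\<^sub>C\<close> 75)
    and cinner :: "'a \<Rightarrow> 'a \<Rightarrow> complex"
  assumes scaleC_add_right: "c *\<^sub>C (x + y) = c *\<^sub>C x + c *\<^sub>C y"
    and scaleC_add_left: "(c + d) *\<^sub>C x = c *\<^sub>C x + d *\<^sub>C x"
    and scaleC_scaleC: "c *\<^sub>C d *\<^sub>C x = (c * d) *\<^sub>C x"
    and scaleC_of_real: "complex_of_real r *\<^sub>C x = r *\<^sub>R x"
    and cinner_add_left: "cinner (x + y) z = cinner x z + cinner y z"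
    and cinner_scaleC_left: "cinner (c *\<^sub>C x) y = c * cinner x y"
    and cinner_commute: "cinner x y = cnj (cinner y x)"
    and cinner_self: "cinner x x = complex_of_real ((norm x)\<^sup>2)"

class complex_hilbert = complex_inner + banach

instantiation complex :: complex_hilbert
begin

definition scaleC_complex :: "complex \<Rightarrow> complex \<Rightarrow> complex"
  where "scaleC_complex c x = c * x"

definition cinner_complex :: "complex \<Rightarrow> complex \<Rightarrow> complex"
  where "cinner_complex x y = x * cnj y"

instance
proof
  show "cinner x x = complex_of_real ((norm x)\<^sup>2)" for x :: complex
    by (simp only: cinner_complex_def complex_norm_square)
qed (simp_all add: scaleC_complex_def cinner_complex_def algebra_simps scaleR_conv_of_real)

end

definition bounded_clinear :: "('a::complex_inner \<Rightarrow> 'b::complex_inner) \<Rightarrow> bool"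
  where "bounded_clinear T \<longleftrightarrow>
    bounded_linear T \<and> (\<forall>c x. T (c *\<^sub>C x) = c *\<^sub>C T x)"

definition unconditionally_summable :: "(nat \<Rightarrow> 'a::real_normed_vector) \<Rightarrow> bool"
  where "unconditionally_summable x \<longleftrightarrow> (\<forall>\<pi>. bij \<pi> \<longrightarrow> summable (\<lambda>n. x (\<pi> n)))"

text \<open>
  Infinite matrices and sequences are indexed from 0 instead of 1. A value given
  by \<open>\<Sum>\<close> is meaningful only where the corresponding series is \<open>summable\<close>.
\<close>

definition mat_seq :: "(nat \<Rightarrow> nat \<Rightarrow> complex) \<Rightarrow> (nat \<Rightarrow> 'a::complex_hilbert) \<Rightarrow> nat \<Rightarrow> 'a"
  where "mat_seq E \<Phi> n = (\<Sum>k. E n k *\<^sub>C \<Phi> k)"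

definition E_sequence :: "(nat \<Rightarrow> nat \<Rightarrow> complex) \<Rightarrow> (nat \<Rightarrow> 'a::complex_hilbert) \<Rightarrow> bool"
  where "E_sequence E \<Phi> \<longleftrightarrow> (\<forall>n. summable (\<lambda>k. E n k *\<^sub>C \<Phi> k))"

definition E_Bessel ::
    "(nat \<Rightarrow> nat \<Rightarrow> complex) \<Rightarrow> (nat \<Rightarrow> 'a::complex_hilbert) \<Rightarrow> real \<Rightarrow> bool"
  where "E_Bessel E \<Phi> B \<longleftrightarrow> B > 0 \<and> E_sequence E \<Phi> \<and>
    (\<forall>f. summable (\<lambda>n. (cmod (cinner f (mat_seq E \<Phi> n)))\<^sup>2) \<and>
         (\<Sum>n. (cmod (cinner f (mat_seq E \<Phi> n)))\<^sup>2) \<le> B * (norm f)\<^sup>2)"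

definition multiplier_term ::
    "(nat \<Rightarrow> nat \<Rightarrow> complex) \<Rightarrow> (nat \<Rightarrow> nat \<Rightarrow> complex) \<Rightarrow> (nat \<Rightarrow> complex) \<Rightarrow>
     (nat \<Rightarrow> 'b::complex_hilbert) \<Rightarrow> (nat \<Rightarrow> 'a::complex_hilbert) \<Rightarrow> 'a \<Rightarrow> nat \<Rightarrow> 'b"
  where "multiplier_term E1 E2 m \<Psi> \<Phi> f n =
    (m n * cinner f (mat_seq E1 \<Phi> n)) *\<^sub>C mat_seq E2 \<Psi> n"

definition multiplier ::
    "(nat \<Rightarrow> nat \<Rightarrow> complex) \<Rightarrow> (nat \<Rightarrow> nat \<Rightarrow> complex) \<Rightarrow> (nat \<Rightarrow> complex) \<Rightarrow>
     (nat \<Rightarrow> 'b::complex_hilbert) \<Rightarrow> (nat \<Rightarrow> 'a::complex_hilbert) \<Rightarrow> 'a \<Rightarrow> 'b"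
  where "multiplier E1 E2 m \<Psi> \<Phi> f = (\<Sum>n. multiplier_term E1 E2 m \<Psi> \<Phi> f n)"

definition multiplier_well_defined ::
    "(nat \<Rightarrow> nat \<Rightarrow> complex) \<Rightarrow> (nat \<Rightarrow> nat \<Rightarrow> complex) \<Rightarrow> (nat \<Rightarrow> complex) \<Rightarrow>
     (nat \<Rightarrow> 'b::complex_hilbert) \<Rightarrow> (nat \<Rightarrow> 'a::complex_hilbert) \<Rightarrow> bool"
  where "multiplier_well_defined E1 E2 m \<Psi> \<Phi> \<longleftrightarrow>
    (\<forall>f. summable (multiplier_term E1 E2 m \<Psi> \<Phi> f))"

end

theory Submission
  imports Defs
begin

text \<open>
  Write \<open>u = E\<^sub>1\<Phi>\<close> and \<open>v = E\<^sub>2\<Psi>\<close>. These are Bessel sequences in the classical sense, with bounds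
  \<open>B\<close> and \<open>B'\<close>, and the multiplier is the composition of three maps. The analysis map sends \<open>f\<close> to
  \<open>(\<langle>f, u\<^sub>n\<rangle>)\<close> in \<open>\<ell>\<^sup>2\<close> with norm at most \<open>sqrt B\<close> by the Bessel inequality itself, multiplication by
  \<open>m\<close> acts on \<open>\<ell>\<^sup>2\<close> with norm at most the supremum of \<open>\<bar>m\<^sub>n\<bar>\<close>, and the synthesis map sends \<open>c\<close> to
  \<open>\<Sum>n. c\<^sub>n v\<^sub>n\<close>.

  The substance lies in the synthesis map, where duality turns the Bessel inequality into
  \<open>\<parallel>\<Sum>n\<in>F. c\<^sub>n v\<^sub>n\<parallel> \<le> sqrt B' * sqrt (\<Sum>n\<in>F. \<bar>c\<^sub>n\<bar>\<^sup>2)\<close> for every finite \<open>F\<close>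
  (\<open>norm_synthesis_sum_le\<close>). For \<open>c\<close> in \<open>\<ell>\<^sup>2\<close> this makes the partial sums Cauchy
  (\<open>summable_synthesis\<close>) and bounds the limit (\<open>norm_synthesis_le\<close>). Unconditional convergence
  needs no additional estimate: permuting \<open>c\<close> and \<open>v\<close> simultaneously preserves both square
  summability and the Bessel bound, so every rearranged series converges for the same reason.
\<close>

section \<open>Complex inner product spaces\<close>

lemma cinner_zero_left: "cinner 0 (y::'a::complex_inner) = 0"
  using cinner_add_left[of 0 0 y] by simp

lemma cinner_sum_left:
  fixes x :: "'i \<Rightarrow> 'a::complex_inner"
  shows "cinner (\<Sum>i\<in>F. x i) y = (\<Sum>i\<in>F. cinner (x i) y)"
  by (induction F rule: infinite_finite_induct) (auto simp: cinner_zero_left cinner_add_left)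

lemma cmod_cinner_commute: "cmod (cinner x (y::'a::complex_inner)) = cmod (cinner y x)"
  by (metis cinner_commute complex_mod_cnj)

lemma cinner_scaleC_right: "cinner x (c *\<^sub>C (y::'a::complex_inner)) = cnj c * cinner x y"
  by (metis cinner_commute cinner_scaleC_left complex_cnj_mult)

lemma norm_scaleC: "norm (c *\<^sub>C (x::'a::complex_inner)) = cmod c * norm x"
proof -
  have "complex_of_real ((norm (c *\<^sub>C x))\<^sup>2) = (c * cnj c) * complex_of_real ((norm x)\<^sup>2)"
    by (simp only: cinner_self[symmetric] cinner_scaleC_left cinner_scaleC_right mult_ac)
  also have "\<dots> = complex_of_real ((cmod c * norm x)\<^sup>2)"
    by (simp only: complex_norm_square[symmetric] of_real_mult[symmetric] power_mult_distrib)
  finally have "(norm (c *\<^sub>C x))\<^sup>2 = (cmod c * norm x)\<^sup>2"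
    by (simp only: of_real_eq_iff)
  then show ?thesis
    by (rule power2_eq_imp_eq) auto
qed

lemma bounded_linear_scaleC: "bounded_linear (\<lambda>x::'a::complex_inner. c *\<^sub>C x)"
  by (rule bounded_linear_intro[where K = "cmod c"])
    (simp_all add: scaleC_add_right scaleC_of_real[symmetric] scaleC_scaleC norm_scaleC mult.commute)

section \<open>Bessel sequences and the synthesis map\<close>

text \<open>
  Bounding all finite sums, instead of the series, makes the condition visibly independent of
  the order of the vectors.
\<close>

definition bessel_bound :: "(nat \<Rightarrow> 'a::complex_inner) \<Rightarrow> real \<Rightarrow> bool"
  where "bessel_bound v B \<longleftrightarrow> 0 \<le> B \<and>
    (\<forall>f F. finite F \<longrightarrow> (\<Sum>n\<in>F. (cmod (cinner f (v n)))\<^sup>2) \<le> B * (norm f)\<^sup>2)"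

lemma bessel_bound_mat_seq:
  assumes "E_Bessel E \<Phi> B"
  shows "bessel_bound (mat_seq E \<Phi>) B"
  unfolding bessel_bound_def
proof (intro conjI allI impI)
  show "0 \<le> B"
    using assms by (simp add: E_Bessel_def)
  fix f :: 'a and F :: "nat set"
  assume "finite F"
  then have "(\<Sum>n\<in>F. (cmod (cinner f (mat_seq E \<Phi> n)))\<^sup>2)
      \<le> (\<Sum>n. (cmod (cinner f (mat_seq E \<Phi> n)))\<^sup>2)"
    using assms by (intro sum_le_suminf) (auto simp: E_Bessel_def)
  also have "\<dots> \<le> B * (norm f)\<^sup>2"
    using assms by (simp add: E_Bessel_def)
  finally show "(\<Sum>n\<in>F. (cmod (cinner f (mat_seq E \<Phi> n)))\<^sup>2) \<le> B * (norm f)\<^sup>2" .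
qed

lemma bessel_bound_compose_inj:
  assumes "bessel_bound v B" "inj \<pi>"
  shows "bessel_bound (v \<circ> \<pi>) B"
  unfolding bessel_bound_def
proof (intro conjI allI impI)
  show "0 \<le> B"
    using assms by (simp add: bessel_bound_def)
  fix f :: 'a and F :: "nat set"
  assume F: "finite F"
  have "(\<Sum>n\<in>F. (cmod (cinner f ((v \<circ> \<pi>) n)))\<^sup>2) = (\<Sum>n\<in>\<pi> ` F. (cmod (cinner f (v n)))\<^sup>2)"
    using inj_on_subset[OF \<open>inj \<pi>\<close>] by (subst sum.reindex) auto
  also have "\<dots> \<le> B * (norm f)\<^sup>2"
    using assms F by (simp add: bessel_bound_def)
  finally show "(\<Sum>n\<in>F. (cmod (cinner f ((v \<circ> \<pi>) n)))\<^sup>2) \<le> B * (norm f)\<^sup>2" .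
qed

text \<open>
  Duality: pairing the sum \<open>s\<close> with itself gives \<open>\<parallel>s\<parallel>\<^sup>2 = \<Sum>n\<in>F. c\<^sub>n \<langle>v\<^sub>n, s\<rangle>\<close>. The
  Cauchy-Schwarz inequality in \<open>\<ell>\<^sup>2\<close> separates the coefficients from the numbers \<open>\<langle>v\<^sub>n, s\<rangle>\<close>, whose
  squares sum to at most \<open>B \<parallel>s\<parallel>\<^sup>2\<close>; one factor \<open>\<parallel>s\<parallel>\<close> then cancels.
\<close>

lemma norm_synthesis_sum_le:
  fixes v :: "nat \<Rightarrow> 'a::complex_inner"
  assumes "bessel_bound v B" "finite F"
  shows "norm (\<Sum>n\<in>F. c n *\<^sub>C v n) \<le> sqrt B * sqrt (\<Sum>n\<in>F. (cmod (c n))\<^sup>2)"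
proof -
  define s where "s = (\<Sum>n\<in>F. c n *\<^sub>C v n)"
  have "(norm s)\<^sup>2 = cmod (cinner s s)"
    by (simp add: cinner_self norm_power)
  also have "cinner s s = (\<Sum>n\<in>F. c n * cinner (v n) s)"
    by (subst s_def) (simp add: cinner_sum_left cinner_scaleC_left)
  also have "cmod \<dots> \<le> (\<Sum>n\<in>F. \<bar>cmod (c n)\<bar> * \<bar>cmod (cinner s (v n))\<bar>)"
    by (rule sum_norm_le) (simp add: norm_mult cmod_cinner_commute)
  also have "\<dots> \<le> L2_set (\<lambda>n. cmod (c n)) F * L2_set (\<lambda>n. cmod (cinner s (v n))) F"
    by (rule L2_set_mult_ineq)
  also have "L2_set (\<lambda>n. cmod (cinner s (v n))) F \<le> sqrt (B * (norm s)\<^sup>2)"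
    using assms by (simp add: L2_set_def bessel_bound_def)
  then have "L2_set (\<lambda>n. cmod (c n)) F * L2_set (\<lambda>n. cmod (cinner s (v n))) F
      \<le> L2_set (\<lambda>n. cmod (c n)) F * sqrt (B * (norm s)\<^sup>2)"
    by (rule mult_left_mono) (rule L2_set_nonneg)
  finally have "norm s * norm s \<le> (sqrt B * sqrt (\<Sum>n\<in>F. (cmod (c n))\<^sup>2)) * norm s"
    by (simp add: L2_set_def real_sqrt_mult power2_eq_square mult_ac)
  moreover have "0 \<le> sqrt B * sqrt (\<Sum>n\<in>F. (cmod (c n))\<^sup>2)"
    using assms by (auto simp: bessel_bound_def intro!: mult_nonneg_nonneg sum_nonneg)
  ultimately have "norm s \<le> sqrt B * sqrt (\<Sum>n\<in>F. (cmod (c n))\<^sup>2)"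
    by (cases "s = 0") auto
  then show ?thesis
    by (simp add: s_def)
qed

lemma summable_synthesis:
  fixes v :: "nat \<Rightarrow> 'a::complex_hilbert"
  assumes v: "bessel_bound v B" and c: "summable (\<lambda>n. (cmod (c n))\<^sup>2)"
  shows "summable (\<lambda>n. c n *\<^sub>C v n)"
  unfolding summable_Cauchy
proof (intro allI impI)
  fix e :: real
  assume "e > 0"
  have "B \<ge> 0"
    using v by (simp add: bessel_bound_def)
  \<comment> \<open>The denominator \<open>B + 1\<close> also covers \<open>B = 0\<close>.\<close>
  have "e\<^sup>2 / (B + 1) > 0"
    using \<open>e > 0\<close> \<open>B \<ge> 0\<close> by simp
  then obtain N where N: "\<And>k n. k \<ge> N \<Longrightarrow> norm (\<Sum>i=k..<n. (cmod (c i))\<^sup>2) < e\<^sup>2 / (B + 1)"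
    using c unfolding summable_Cauchy by meson
  have "norm (\<Sum>i=k..<n. c i *\<^sub>C v i) < e" if "k \<ge> N" for k n
  proof -
    define q where "q = (\<Sum>i=k..<n. (cmod (c i))\<^sup>2)"
    have q: "0 \<le> q" "q < e\<^sup>2 / (B + 1)"
      using N[OF that, of n] by (auto simp: q_def sum_nonneg)
    have "B * q \<le> (B + 1) * q"
      using q by (simp add: mult_right_mono)
    also have "\<dots> < e\<^sup>2"
      using q \<open>B \<ge> 0\<close> by (simp add: field_simps)
    finally have "sqrt (B * q) < e"
      using \<open>e > 0\<close> by (intro real_less_lsqrt) auto
    then show ?thesis
      using norm_synthesis_sum_le[OF v, of "{k..<n}" c] by (simp add: q_def real_sqrt_mult)
  qed
  then show "\<exists>N. \<forall>k\<ge>N. \<forall>n. norm (\<Sum>i=k..<n. c i *\<^sub>C v i) < e"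
    by blast
qed

lemma norm_synthesis_le:
  fixes v :: "nat \<Rightarrow> 'a::complex_hilbert"
  assumes v: "bessel_bound v B" and c: "summable (\<lambda>n. (cmod (c n))\<^sup>2)"
  shows "norm (\<Sum>n. c n *\<^sub>C v n) \<le> sqrt B * sqrt (\<Sum>n. (cmod (c n))\<^sup>2)"
proof (rule LIMSEQ_le)
  show "(\<lambda>N. norm (\<Sum>n<N. c n *\<^sub>C v n)) \<longlonglongrightarrow> norm (\<Sum>n. c n *\<^sub>C v n)"
    by (intro tendsto_norm summable_LIMSEQ summable_synthesis[OF v c])
  show "(\<lambda>N. sqrt B * sqrt (\<Sum>n<N. (cmod (c n))\<^sup>2)) \<longlonglongrightarrow> sqrt B * sqrt (\<Sum>n. (cmod (c n))\<^sup>2)"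
    by (intro tendsto_intros summable_LIMSEQ c)
  show "\<exists>N0. \<forall>N\<ge>N0. norm (\<Sum>n<N. c n *\<^sub>C v n) \<le> sqrt B * sqrt (\<Sum>n<N. (cmod (c n))\<^sup>2)"
    using norm_synthesis_sum_le[OF v] by blast
qed

lemma unconditionally_summable_synthesis:
  fixes v :: "nat \<Rightarrow> 'a::complex_hilbert"
  assumes v: "bessel_bound v B" and c: "summable (\<lambda>n. (cmod (c n))\<^sup>2)"
  shows "unconditionally_summable (\<lambda>n. c n *\<^sub>C v n)"
  unfolding unconditionally_summable_def
proof (intro allI impI)
  fix \<pi> :: "nat \<Rightarrow> nat"
  assume "bij \<pi>"
  then have inj: "inj \<pi>"
    by (rule bij_is_inj)
  have "summable (\<lambda>n. (cmod ((c \<circ> \<pi>) n))\<^sup>2)"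
    using summable_reindex[OF c inj] by (simp add: o_def)
  then show "summable (\<lambda>n. c (\<pi> n) *\<^sub>C v (\<pi> n))"
    using summable_synthesis[OF bessel_bound_compose_inj[OF v inj]] by simp
qed

section \<open>Bounded symbols and multipliers\<close>

lemma square_summable_bounded_mult:
  fixes m a :: "nat \<Rightarrow> complex"
  assumes m: "\<And>n. cmod (m n) \<le> K" and a: "summable (\<lambda>n. (cmod (a n))\<^sup>2)"
  shows "summable (\<lambda>n. (cmod (m n * a n))\<^sup>2)"
    and "(\<Sum>n. (cmod (m n * a n))\<^sup>2) \<le> K\<^sup>2 * (\<Sum>n. (cmod (a n))\<^sup>2)"
proof -
  have le: "(cmod (m n * a n))\<^sup>2 \<le> K\<^sup>2 * (cmod (a n))\<^sup>2" for n
    using m[of n] by (simp add: norm_mult power_mult_distrib mult_right_mono power_mono)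
  show *: "summable (\<lambda>n. (cmod (m n * a n))\<^sup>2)"
    by (rule summable_comparison_test'[OF summable_mult[OF a, of "K\<^sup>2"]]) (use le in simp)
  show "(\<Sum>n. (cmod (m n * a n))\<^sup>2) \<le> K\<^sup>2 * (\<Sum>n. (cmod (a n))\<^sup>2)"
    by (subst suminf_mult[OF a, symmetric]) (intro suminf_le le * summable_mult a)
qed

lemma multiplier_add:
  assumes "multiplier_well_defined E1 E2 m \<Psi> \<Phi>"
  shows "multiplier E1 E2 m \<Psi> \<Phi> (f + g) = multiplier E1 E2 m \<Psi> \<Phi> f + multiplier E1 E2 m \<Psi> \<Phi> g"
proof -
  have "multiplier_term E1 E2 m \<Psi> \<Phi> (f + g)
      = (\<lambda>n. multiplier_term E1 E2 m \<Psi> \<Phi> f n + multiplier_term E1 E2 m \<Psi> \<Phi> g n)"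
    by (simp add: fun_eq_iff multiplier_term_def cinner_add_left distrib_left scaleC_add_left)
  then show ?thesis
    using assms by (simp add: multiplier_def multiplier_well_defined_def suminf_add)
qed

lemma multiplier_scaleC:
  assumes "multiplier_well_defined E1 E2 m \<Psi> \<Phi>"
  shows "multiplier E1 E2 m \<Psi> \<Phi> (c *\<^sub>C f) = c *\<^sub>C multiplier E1 E2 m \<Psi> \<Phi> f"
proof -
  have "multiplier_term E1 E2 m \<Psi> \<Phi> (c *\<^sub>C f) = (\<lambda>n. c *\<^sub>C multiplier_term E1 E2 m \<Psi> \<Phi> f n)"
    by (simp add: fun_eq_iff multiplier_term_def cinner_scaleC_left scaleC_scaleC mult_ac)
  then show ?thesis
    using assms bounded_linear.suminf[OF bounded_linear_scaleC, of "multiplier_term E1 E2 m \<Psi> \<Phi> f" c]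
    by (simp add: multiplier_def multiplier_well_defined_def)
qed

theorem theorem2p2p4:
  fixes E1 E2 :: "nat \<Rightarrow> nat \<Rightarrow> complex"
    and \<Phi> :: "nat \<Rightarrow> 'a::complex_hilbert"
    and \<Psi> :: "nat \<Rightarrow> 'b::complex_hilbert"
    and m :: "nat \<Rightarrow> complex"
    and B B' :: real
  assumes "separable_space (euclidean :: 'a topology)"
    and "separable_space (euclidean :: 'b topology)"
    and "E_Bessel E1 \<Phi> B"
    and "E_Bessel E2 \<Psi> B'"
    and "bounded (range m)"
  shows "multiplier_well_defined E1 E2 m \<Psi> \<Phi> \<and>
    bounded_clinear (multiplier E1 E2 m \<Psi> \<Phi>) \<and>
    onorm (multiplier E1 E2 m \<Psi> \<Phi>) \<le> sqrt B * sqrt B' * (SUP n. cmod (m n)) \<and>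
    (\<forall>f. unconditionally_summable (multiplier_term E1 E2 m \<Psi> \<Phi> f))"
proof -
  let ?M = "multiplier E1 E2 m \<Psi> \<Phi>"
  define K where "K = (SUP n. cmod (m n))"
  define a where "a f n = cinner f (mat_seq E1 \<Phi> n)" for f n
  have v: "bessel_bound (mat_seq E2 \<Psi>) B'"
    by (rule bessel_bound_mat_seq) fact
  have a: "summable (\<lambda>n. (cmod (a f n))\<^sup>2)" "(\<Sum>n. (cmod (a f n))\<^sup>2) \<le> B * (norm f)\<^sup>2" for f
    using assms(3) by (simp_all add: E_Bessel_def a_def)
  have "bdd_above (range (\<lambda>n. cmod (m n)))"
    using assms(5) by (auto simp: bounded_iff bdd_above_def)
  then have mK: "cmod (m n) \<le> K" for n
    unfolding K_def by (intro cSUP_upper) auto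
  then have "K \<ge> 0"
    using norm_ge_zero order_trans by blast
  have bounds: "B > 0" "B' > 0"
    using assms by (auto simp: E_Bessel_def)
  have ma: "summable (\<lambda>n. (cmod (m n * a f n))\<^sup>2)"
    "(\<Sum>n. (cmod (m n * a f n))\<^sup>2) \<le> K\<^sup>2 * (\<Sum>n. (cmod (a f n))\<^sup>2)" for f
    by (rule square_summable_bounded_mult[where K = K, OF _ a(1)], rule mK)+
  have term_eq: "multiplier_term E1 E2 m \<Psi> \<Phi> f = (\<lambda>n. (m n * a f n) *\<^sub>C mat_seq E2 \<Psi> n)" for f
    by (simp add: fun_eq_iff multiplier_term_def a_def)
  have wd: "multiplier_well_defined E1 E2 m \<Psi> \<Phi>"
    unfolding multiplier_well_defined_def term_eq using summable_synthesis[OF v ma(1)] by blast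
  have norm_le: "norm (?M f) \<le> (sqrt B * sqrt B' * K) * norm f" for f
  proof -
    have "norm (?M f) \<le> sqrt B' * sqrt (\<Sum>n. (cmod (m n * a f n))\<^sup>2)"
      unfolding multiplier_def term_eq by (rule norm_synthesis_le[OF v ma(1)])
    also have "(\<Sum>n. (cmod (m n * a f n))\<^sup>2) \<le> K\<^sup>2 * (B * (norm f)\<^sup>2)"
      by (rule order_trans[OF ma(2)]) (simp add: a(2) mult_left_mono)
    then have "sqrt B' * sqrt (\<Sum>n. (cmod (m n * a f n))\<^sup>2) \<le> sqrt B' * sqrt (K\<^sup>2 * (B * (norm f)\<^sup>2))"
      using bounds by (simp add: mult_left_mono)
    also have "\<dots> = (sqrt B * sqrt B' * K) * norm f"
      using \<open>K \<ge> 0\<close> by (simp add: real_sqrt_mult mult_ac)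
    finally show ?thesis .
  qed
  have "bounded_linear ?M"
  proof (rule bounded_linear_intro)
    show "?M (r *\<^sub>R f) = r *\<^sub>R ?M f" for r f
      using multiplier_scaleC[OF wd, of "complex_of_real r"] by (simp only: scaleC_of_real)
    show "norm (?M f) \<le> norm f * (sqrt B * sqrt B' * K)" for f
      using norm_le[of f] by (simp only: mult.commute)
  qed (rule multiplier_add[OF wd])
  then have "bounded_clinear ?M"
    by (simp add: bounded_clinear_def multiplier_scaleC[OF wd])
  moreover have "onorm ?M \<le> sqrt B * sqrt B' * K"
    by (rule onorm_bound) (use bounds \<open>K \<ge> 0\<close> norm_le in auto)
  moreover have "unconditionally_summable (multiplier_term E1 E2 m \<Psi> \<Phi> f)" for f
    unfolding term_eq by (rule unconditionally_summable_synthesis[OF v ma(1)])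
  ultimately show ?thesis
    using wd by (simp add: K_def)
qed

end
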